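(* Let $q$ be a prime power and $n\ge1$. For any linearized polynomial $L(x)=\sum_{i=0}^{n-1}a_ix^{q^i}\in\mathscr{L}_n(\mathbb{F}_{q^n})$ with associated Dickson matrix $D_L$, one has \[\operatorname{rk} L=\operatorname{rk} D_L\quad\text{and}\quad \det L=\det D_L,\] where $\operatorname{rk}L$ and $\det L$ are the rank and determinant, respectively, of the $\mathbb{F}_q$-linear transformation of $\mathbb{F}_{q^n}$ induced by $L(x)$.
   Context: $\mathscr{L}_n(\mathbb{F}_{q^n})$ is the set of linearized polynomials $\sum_{i=0}^{n-1}a_ix^{q^i}\in\mathbb{F}_{q^n}[x]/(x^{q^n}-x)$, $a_i\in\mathbb{F}_{q^n}$; each induces an $\mathbb{F}_q$-linear map $\mathbb{F}_{q^n}\to\mathbb{F}_{q^n}$. The Dickson matrix associated to $L(x)=\sum_{i=0}^{n-1}a_ix^{q^i}$ is $D_L=\left(a_{j-i}^{q^i}\right)_{0\le i,j\le n-1}$, the $n\times n$ matrix over $\mathbb{F}_{q^n}$ whose $(i,j)$ entry is $a_{j-i}^{q^i}$ (subscripts reduced modulo $n$). $\operatorname{rk}D_L$ is the rank over $\mathbb{F}_{q^n}$, and $\mathbb{F}_q$ is regarded as a subfield of $\mathbb{F}_{q^n}$. *)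

theory Defs
  imports
    "HOL-Library.Cardinality"
    "HOL-Computational_Algebra.Polynomial"
    "HOL-Number_Theory.Prime_Powers"
    "Jordan_Normal_Form.DL_Rank"
begin

text \<open>Endomorphisms of a vector space in the sense of \<open>Vector_Spaces\<close>, given by its scalar
  multiplication \<open>s\<close>.\<close>

definition ordered_basis :: "('a::field \<Rightarrow> 'b::ab_group_add \<Rightarrow> 'b) \<Rightarrow> 'b list \<Rightarrow> bool" where
  "ordered_basis s bs \<longleftrightarrow>
     distinct bs \<and> \<not> Modules.module.dependent s (set bs) \<and> Modules.module.span s (set bs) = UNIV"

text \<open>Rows are indexed by the target basis \<open>bs\<close>, columns by the source basis \<open>cs\<close>: column \<open>j\<close>
  consists of the coordinates of \<open>f (cs ! j)\<close> with respect to \<open>bs\<close>.\<close>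

definition matrix_of ::
    "('a::field \<Rightarrow> 'b::ab_group_add \<Rightarrow> 'b) \<Rightarrow> 'b list \<Rightarrow> 'b list \<Rightarrow> ('b \<Rightarrow> 'b) \<Rightarrow> 'a mat" where
  "matrix_of s bs cs f =
     mat (length bs) (length cs)
       (\<lambda>(i, j). Modules.module.representation s (set bs) (f (cs ! j)) (bs ! i))"

definition linear_rank :: "('a::field \<Rightarrow> 'b::ab_group_add \<Rightarrow> 'b) \<Rightarrow> ('b \<Rightarrow> 'b) \<Rightarrow> nat" where
  "linear_rank s f = vector_space.dim s (range f)"

text \<open>The determinant of an endomorphism of a finite-dimensional space, computed in an arbitrary
  ordered basis; \<open>linear_det_eq\<close> below shows that the choice is irrelevant.\<close>

definition linear_det :: "('a::field \<Rightarrow> 'b::ab_group_add \<Rightarrow> 'b) \<Rightarrow> ('b \<Rightarrow> 'b) \<Rightarrow> 'a" where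
  "linear_det s f = (let bs = (SOME bs. ordered_basis s bs) in det (matrix_of s bs bs f))"

lemma (in vector_space) ordered_basis_sum:
  assumes "ordered_basis scale bs"
  shows "(\<Sum>i<length bs. scale (representation (set bs) v (bs ! i)) (bs ! i)) = v"
proof -
  have bij: "bij_betw ((!) bs) {..<length bs} (set bs)"
    using assms bij_betw_nth[of bs] by (simp add: ordered_basis_def)
  have "(\<Sum>b\<in>set bs. scale (representation (set bs) v b) b) = v"
    using assms by (intro sum_representation_eq) (auto simp: ordered_basis_def)
  then show ?thesis
    using sum.reindex_bij_betw[OF bij, of "\<lambda>b. scale (representation (set bs) v b) b"] by simp
qed

lemma (in vector_space) matrix_of_comp:
  assumes f: "Vector_Spaces.linear scale scale f"
    and bs: "ordered_basis scale bs" and cs: "ordered_basis scale cs"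
  shows "matrix_of scale bs cs f * matrix_of scale cs ds g = matrix_of scale bs ds (f \<circ> g)"
proof (rule eq_matI)
  fix i j assume "i < dim_row (matrix_of scale bs ds (f \<circ> g))" "j < dim_col (matrix_of scale bs ds (f \<circ> g))"
  then have ij: "i < length bs" "j < length ds" by (simp_all add: matrix_of_def)
  let ?r = "\<lambda>v. representation (set bs) v (bs ! i)"
  interpret f: Vector_Spaces.linear scale scale f by (fact f)
  interpret r: Vector_Spaces.linear scale "(*)" ?r
    using bs by (intro linear_representation) (auto simp: ordered_basis_def)
  have "?r (f (g (ds ! j))) =
    ?r (f (\<Sum>k<length cs. scale (representation (set cs) (g (ds ! j)) (cs ! k)) (cs ! k)))"
    using local.ordered_basis_sum[OF cs] by simp
  also have "\<dots> = (\<Sum>k<length cs. ?r (f (cs ! k)) * representation (set cs) (g (ds ! j)) (cs ! k))"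
    by (simp add: f.sum f.scale r.sum r.scale mult.commute)
  finally show "(matrix_of scale bs cs f * matrix_of scale cs ds g) $$ (i, j) = matrix_of scale bs ds (f \<circ> g) $$ (i, j)"
    using ij by (simp add: matrix_of_def scalar_prod_def lessThan_atLeast0)
qed (simp_all add: matrix_of_def)

lemma (in vector_space) matrix_of_id:
  assumes "ordered_basis scale bs"
  shows "matrix_of scale bs bs id = 1\<^sub>m (length bs)"
  using assms
  by (intro eq_matI)
    (auto simp: matrix_of_def ordered_basis_def representation_basis nth_eq_iff_index_eq)

lemma (in vector_space) ordered_basis_length:
  assumes "ordered_basis scale bs" "ordered_basis scale cs"
  shows "length bs = length cs"
  using assms unfolding ordered_basis_def
  by (metis basis_card_eq_dim distinct_card span_superset subset_UNIV)

lemma (in vector_space) linear_det_eq: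
  assumes f: "Vector_Spaces.linear scale scale f" and bs: "ordered_basis scale bs"
  shows "linear_det scale f = det (matrix_of scale bs bs f)"
proof -
  define cs where "cs = (SOME cs. ordered_basis scale cs)"
  have cs: "ordered_basis scale cs" unfolding cs_def using bs by (rule someI)
  let ?n = "length bs"
  have len: "length cs = ?n" using local.ordered_basis_length[OF cs bs] .
  have car: "matrix_of scale xs ys h \<in> carrier_mat (length xs) (length ys)" for xs ys h
    by (simp add: matrix_of_def)
  have id: "Vector_Spaces.linear scale scale id" by (rule linear_id)
  have "matrix_of scale cs cs f = matrix_of scale cs bs id * (matrix_of scale bs bs f * matrix_of scale bs cs id)"
    by (simp add: local.matrix_of_comp[OF f bs bs] local.matrix_of_comp[OF id cs bs])
  then have "det (matrix_of scale cs cs f) =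
      det (matrix_of scale cs bs id) * (det (matrix_of scale bs bs f) * det (matrix_of scale bs cs id))"
    using car[of cs bs id] car[of bs bs f] car[of bs cs id]
    by (simp add: len det_mult[of _ ?n])
  moreover have "det (matrix_of scale cs bs id) * det (matrix_of scale bs cs id) = 1"
    using car[of cs bs id] car[of bs cs id] local.matrix_of_comp[OF id cs bs, of cs id]
    by (simp add: len local.matrix_of_id[OF cs] flip: det_mult[of _ ?n])
  ultimately have "det (matrix_of scale cs cs f) = det (matrix_of scale bs bs f)"
    by (simp add: algebra_simps)
  then show ?thesis by (simp add: linear_det_def cs_def Let_def)
qed


text \<open>The inclusion of \<open>F_q\<close> in \<open>F_(q^n)\<close> is given as a field homomorphism \<open>\<iota>\<close> (necessarily
  injective); it makes the larger field a vector space over the smaller one.\<close>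

definition ext_scale :: "('k::field \<Rightarrow> 'a::field) \<Rightarrow> 'k \<Rightarrow> 'a \<Rightarrow> 'a" where
  "ext_scale \<iota> c x = \<iota> c * x"

lemma (in field_hom) vector_space_ext_scale: "vector_space (ext_scale hom)"
  by unfold_locales (simp_all add: ext_scale_def algebra_simps hom_add hom_mult)

text \<open>Classes modulo \<open>x^(q^n) - x\<close> are represented by their unique representatives of degree
  less than \<open>q^n\<close>.\<close>

definition linearized_polys :: "nat \<Rightarrow> nat \<Rightarrow> 'a::comm_semiring_1 poly set" where
  "linearized_polys q n = {L. \<exists>a :: nat \<Rightarrow> 'a. L = (\<Sum>i<n. monom (a i) (q ^ i))}"

text \<open>The subscript \<open>j - i\<close> modulo \<open>n\<close> is written \<open>(n + j - i) mod n\<close> to avoid truncated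
  subtraction.\<close>

definition dickson_matrix :: "nat \<Rightarrow> nat \<Rightarrow> 'a::comm_semiring_1 poly \<Rightarrow> 'a mat" where
  "dickson_matrix q n L =
     mat n n (\<lambda>(i, j). coeff L (q ^ ((n + j - i) mod n)) ^ (q ^ i))"

end

theory Submission
  imports Defs
begin

text \<open>
  Write \<open>m(x) = (x, x\<^sup>q, \<dots>, x^(q^(n-1)))\<close> for the vector of Frobenius conjugates of \<open>x\<close>. Two facts
  link the endomorphism \<open>L\<close> over the small field to the matrix \<open>D\<close> over the large one.

  \<^item> \<open>D m(x) = m(L(x))\<close>: raising \<open>L(x) = \<Sum>l. a\<^sub>l x^(q^l)\<close> to the power \<open>q^i\<close> is additive, and
    \<open>x^(q^n) = x\<close> allows exponents \<open>l + i\<close> to be read modulo \<open>n\<close>; the result is the \<open>i\<close>-th row of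
    \<open>D\<close> applied to \<open>m(x)\<close> (\<open>dickson_mult_moore_vec\<close>).

  \<^item> If \<open>b\<^sub>1, \<dots>, b\<^sub>n\<close> is a basis over the small field, the Moore matrix \<open>M\<close> with columns \<open>m(b\<^sub>j)\<close> is
    invertible: a row vector \<open>v\<close> with \<open>v M = 0\<close> gives a linearized polynomial with coefficients
    \<open>v\<close> and degree less than \<open>q^n\<close> that vanishes on a basis, hence at all \<open>q^n\<close> points, so it is
    zero (\<open>det_moore_mat_nonzero\<close>).

  For the determinant, let \<open>A\<close> be the matrix of \<open>L\<close> in the basis. Since \<open>m\<close> is linear over the small
  field, expanding \<open>L(b\<^sub>j)\<close> in the basis turns the first fact into \<open>D M = M A\<close>, so \<open>D\<close> and \<open>A\<close>
  are similar over the large field.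

  For the rank, \<open>D\<close> has the rank of \<open>D M\<close>, whose columns are the \<open>m(L(b\<^sub>j))\<close>. By the second fact
  \<open>m\<close> carries sets independent over the small field to sets independent over the large field,
  because such a set extends to a basis. So the column rank over the large field is the dimension
  over the small field of the span of the \<open>L(b\<^sub>j)\<close>, which is the range of \<open>L\<close>
  (\<open>rank_moore_mat\<close>).
\<close>


section \<open>Finite fields and matrix rank\<close>

text \<open>Multiplication by a nonzero \<open>x\<close> permutes the nonzero elements, so their product absorbs a factor
  \<open>x\<close> for each of them.\<close>

lemma power_card_eq_self:
  fixes x :: "'a::{field, finite}"
  shows "x ^ CARD('a) = x"
proof (cases "x = 0")
  case False
  have "(\<Prod>y\<in>UNIV - {0}. x * y) = (\<Prod>y\<in>UNIV - {0}. y)"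
    by (rule prod.reindex_bij_witness[of _ "\<lambda>y. y / x" "\<lambda>y. x * y"]) (use False in auto)
  then have "x ^ (CARD('a) - 1) = 1"
    by (simp add: prod.distrib card_Diff_singleton)
  then show ?thesis
    by (metis One_nat_def Suc_pred finite_UNIV_card_ge_0 finite power_Suc2 mult_1)
qed simp

text \<open>Translation by \<open>1\<close> permutes the field, so the sum of all elements absorbs a \<open>1\<close> for each of
  them.\<close>

lemma of_nat_card_eq_0: "of_nat CARD('a::{field, finite}) = (0::'a)"
proof -
  have "(\<Sum>x\<in>(UNIV::'a set). x + 1) = (\<Sum>x\<in>UNIV. x)"
    by (rule sum.reindex_bij_witness[of _ "\<lambda>y. y - 1" "\<lambda>y. y + 1"]) auto
  then show ?thesis by (simp add: sum.distrib)
qed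

text \<open>\<open>A\<close> and \<open>A P\<close> even have the same column space.\<close>

lemma (in vec_space) rank_mult_invertible_right:
  assumes A: "A \<in> carrier_mat n m" and P: "P \<in> carrier_mat m m" and det: "det P \<noteq> 0"
  shows "rank (A * P) = rank A"
proof -
  obtain Q where Q: "Q \<in> carrier_mat m m" and PQ: "P * Q = 1\<^sub>m m"
    using det_non_zero_imp_unit[OF P det, of "()"] P
    unfolding Units_def ring_mat_def by auto
  have AP: "A * P \<in> carrier_mat n m" using A P by simp
  have "col_space (A * P) = col_space A"
  proof (intro equalityI subsetI)
    fix y assume "y \<in> col_space (A * P)"
    then obtain x where "x \<in> carrier_vec m" "(A * P) *\<^sub>v x = y"
      using A P unfolding col_space_eq[OF AP] by auto
    then show "y \<in> col_space A"
      using A P unfolding col_space_eq[OF A] by auto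
  next
    fix y assume "y \<in> col_space A"
    then obtain x where x: "x \<in> carrier_vec m" "A *\<^sub>v x = y"
      using A unfolding col_space_eq[OF A] by auto
    have "(A * P) *\<^sub>v (Q *\<^sub>v x) = A *\<^sub>v ((P * Q) *\<^sub>v x)"
      using A P Q x(1) by (simp add: assoc_mult_mat_vec[of _ _ m])
    also have "\<dots> = y" using x PQ by simp
    finally show "y \<in> col_space (A * P)"
      using A P Q x unfolding col_space_eq[OF AP] by auto
  qed
  then show ?thesis by (simp add: rank_def col_space_def)
qed


section \<open>Frobenius powers and linearized polynomials\<close>

locale finite_field_extension = field_hom \<iota>
  for \<iota> :: "'k::{field, finite} \<Rightarrow> 'a::{field, finite}" +
  fixes q n :: nat
  assumes primepow_q: "primepow q"
    and card_base: "CARD('k) = q" and card_ext: "CARD('a) = q ^ n"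
begin

sublocale V: vector_space "ext_scale \<iota>"
  by (rule vector_space_ext_scale)

lemma q_gt_1: "q > 1"
  using primepow_q primepow_gt_Suc_0 by auto

lemma n_pos: "n > 0"
proof (rule ccontr)
  assume "\<not> n > 0"
  then have "CARD('a) = 1" using card_ext by simp
  then have "(0::'a) = 1" by (metis (full_types) card_1_singletonE UNIV_I singletonD)
  then show False by simp
qed

text \<open>The prime \<open>p\<close> of which \<open>q\<close> is a power is the characteristic, since the characteristic is a prime
  dividing \<open>q^n\<close>. This is what makes \<open>x \<mapsto> x^(q^i)\<close> additive.\<close>

lemma prime_CHAR: "prime CHAR('a)"
  and q_eq_CHAR_power: "\<exists>m. q = CHAR('a) ^ m"
proof -
  show pr: "prime CHAR('a)"
    using finite_imp_CHAR_pos[where ?'a = 'a] prime_CHAR_semidom[where ?'a = 'a] by simp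
  obtain p k where pk: "prime p" "k > 0" "q = p ^ k"
    using primepow_q by (auto simp: primepow_def)
  have "CHAR('a) dvd p ^ (k * n)"
    using of_nat_card_eq_0[where ?'a='a] unfolding of_nat_eq_0_iff_char_dvd
    by (simp add: card_ext pk(3) power_mult)
  then have "CHAR('a) = p"
    using pr pk(1) by (metis prime_dvd_power primes_dvd_imp_eq)
  then show "\<exists>m. q = CHAR('a) ^ m" using pk(3) by blast
qed

lemma frobenius_sum:
  fixes f :: "'b \<Rightarrow> 'a"
  shows "(\<Sum>x\<in>A. f x) ^ q ^ i = (\<Sum>x\<in>A. f x ^ q ^ i)"
proof -
  obtain m where m: "q = CHAR('a) ^ m" using q_eq_CHAR_power by blast
  show ?thesis
    by (rule freshmans_dream_sum'[OF prime_CHAR, of _ "m * i"]) (simp add: m power_mult)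
qed

lemma frobenius_add: "(x + y :: 'a) ^ q ^ i = x ^ q ^ i + y ^ q ^ i"
  using frobenius_sum[of "\<lambda>b. if b then x else y" UNIV i] by (simp add: UNIV_bool add.commute)

lemma frobenius_base: "\<iota> c ^ q ^ i = \<iota> c"
proof (induction i)
  case (Suc i)
  have "\<iota> c ^ q = \<iota> c" by (metis hom_power power_card_eq_self card_base)
  then show ?case using Suc by (simp add: power_mult)
qed simp

lemma frobenius_mod: "(x::'a) ^ q ^ (k mod n) = x ^ q ^ k"
proof -
  have per: "(y::'a) ^ q ^ (n * t) = y" for y t
  proof (induction t)
    case (Suc t)
    then show ?case using power_card_eq_self[of y] card_ext by (simp add: power_add power_mult)
  qed simp
  have "x ^ q ^ k = x ^ q ^ (n * (k div n) + k mod n)" by simp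
  also have "\<dots> = (x ^ q ^ (n * (k div n))) ^ q ^ (k mod n)" by (simp only: power_add power_mult)
  finally show ?thesis by (simp only: per)
qed

lemma coeff_linearized:
  assumes "i < n"
  shows "coeff (\<Sum>j<n. monom (a j) (q ^ j)) (q ^ i) = (a i :: 'a)"
proof -
  have "coeff (\<Sum>j<n. monom (a j) (q ^ j)) (q ^ i) = (\<Sum>j<n. if j = i then a j else 0)"
    using q_gt_1 by (auto simp: coeff_sum intro!: sum.cong)
  then show ?thesis using assms by simp
qed

lemma poly_linearized:
  assumes "L \<in> linearized_polys q n"
  shows "poly L x = (\<Sum>i<n. coeff L (q ^ i) * (x::'a) ^ q ^ i)"
  using assms unfolding linearized_polys_def
  by (auto simp: poly_sum poly_monom coeff_linearized)

lemma linear_linearized: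
  assumes "L \<in> linearized_polys q n"
  shows "Vector_Spaces.linear (ext_scale \<iota>) (ext_scale \<iota>) (poly L)"
  unfolding Vector_Spaces.linear_iff
proof (intro conjI allI V.vector_space_axioms)
  fix x y c
  show "poly L (x + y) = poly L x + poly L y"
    by (simp add: poly_linearized[OF assms] frobenius_add distrib_left sum.distrib)
  show "poly L (ext_scale \<iota> c x) = ext_scale \<iota> c (poly L x)"
    by (simp add: poly_linearized[OF assms] ext_scale_def power_mult_distrib frobenius_base
        sum_distrib_left mult.left_commute)
qed

text \<open>Coordinates give a bijection between the large field and the functions from the basis to the
  small field; the length follows by counting.\<close>

lemma ordered_basis_length_eq:
  assumes bs: "ordered_basis (ext_scale \<iota>) bs"
  shows "length bs = n"
proof -
  let ?B = "set bs"
  let ?f = "\<lambda>c. \<Sum>b\<in>?B. ext_scale \<iota> (c b) b"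
  have ind: "V.independent ?B" and sp: "V.span ?B = UNIV" and dist: "distinct bs"
    using bs by (auto simp: ordered_basis_def)
  have "inj_on ?f (PiE ?B (\<lambda>_. UNIV))"
  proof (rule inj_onI)
    fix c d assume c: "c \<in> PiE ?B (\<lambda>_. UNIV)" and d: "d \<in> PiE ?B (\<lambda>_. UNIV)" and eq: "?f c = ?f d"
    have "(\<Sum>b\<in>?B. ext_scale \<iota> (c b - d b) b) = 0"
      using eq by (simp add: V.scale_left_diff_distrib sum_subtractf)
    then have "c b - d b = 0" if "b \<in> ?B" for b
      using V.independentD[OF ind finite_set order_refl _ that, of "\<lambda>b. c b - d b"] by blast
    then show "c = d" using c d by (intro PiE_ext) auto
  qed
  moreover have "?f ` (PiE ?B (\<lambda>_. UNIV)) = UNIV"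
  proof -
    have "x \<in> ?f ` (PiE ?B (\<lambda>_. UNIV))" for x
    proof (rule image_eqI)
      let ?c = "restrict (V.representation ?B x) ?B"
      show "x = ?f ?c"
        using V.sum_representation_eq[OF ind, of x ?B] sp by simp
      show "?c \<in> PiE ?B (\<lambda>_. UNIV)" by simp
    qed
    then show ?thesis by blast
  qed
  ultimately have "CARD('a) = card (PiE ?B (\<lambda>_. UNIV :: 'k set))"
    using card_image[of ?f "PiE ?B (\<lambda>_. UNIV)"] by (simp only:)
  also have "\<dots> = q ^ length bs"
    using dist by (simp add: card_PiE distinct_card card_base)
  finally show ?thesis using card_ext q_gt_1 by simp
qed


section \<open>Moore matrices\<close>

definition moore_vec :: "'a \<Rightarrow> 'a vec" where
  "moore_vec x = vec n (\<lambda>i. x ^ q ^ i)"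

definition moore_mat :: "'a list \<Rightarrow> 'a mat" where
  "moore_mat bs = mat_of_cols n (map moore_vec bs)"

lemma moore_vec_carrier [simp]: "moore_vec x \<in> carrier_vec n"
  by (simp add: moore_vec_def)

lemma moore_mat_carrier [simp]: "moore_mat bs \<in> carrier_mat n (length bs)"
  using mat_of_cols_carrier(1)[of n "map moore_vec bs"] by (simp add: moore_mat_def)

lemma cols_moore_mat: "cols (moore_mat bs) = map moore_vec bs"
  unfolding moore_mat_def by (rule cols_mat_of_cols) auto

lemma moore_mat_index:
  "i < n \<Longrightarrow> j < length bs \<Longrightarrow> moore_mat bs $$ (i, j) = (bs ! j) ^ q ^ i"
  by (simp add: moore_mat_def mat_of_cols_index moore_vec_def)

text \<open>A relation among the rows would be a nonzero linearized polynomial of degree at most \<open>q^(n-1)\<close>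
  with all \<open>q^n\<close> field elements as roots.\<close>

lemma det_moore_mat_nonzero:
  assumes bs: "ordered_basis (ext_scale \<iota>) bs"
  shows "det (moore_mat bs) \<noteq> 0"
proof
  have len: "length bs = n" by (rule ordered_basis_length_eq[OF bs])
  have car: "moore_mat bs \<in> carrier_mat n n" using moore_mat_carrier[of bs] len by simp
  assume "det (moore_mat bs) = 0"
  then have "det (transpose_mat (moore_mat bs)) = 0" using car by (simp add: det_transpose)
  then obtain v where v: "v \<in> carrier_vec n" "v \<noteq> 0\<^sub>v n" "transpose_mat (moore_mat bs) *\<^sub>v v = 0\<^sub>v n"
    using det_0_iff_vec_prod_zero_field[of "transpose_mat (moore_mat bs)" n] car by auto
  define P where "P = (\<Sum>i<n. monom (v $ i) (q ^ i))"
  have P: "P \<in> linearized_polys q n" by (auto simp: P_def linearized_polys_def)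
  interpret P: Vector_Spaces.linear "ext_scale \<iota>" "ext_scale \<iota>" "poly P"
    by (rule linear_linearized[OF P])
  have root: "poly P (bs ! j) = 0" if j: "j < n" for j
  proof -
    have "poly P (bs ! j) = (\<Sum>i<n. moore_mat bs $$ (i, j) * v $ i)"
      using j by (simp add: P_def poly_sum poly_monom moore_mat_index len mult.commute)
    also have "\<dots> = (transpose_mat (moore_mat bs) *\<^sub>v v) $ j"
      using j v(1) car by (simp add: scalar_prod_def lessThan_atLeast0)
    finally show ?thesis using j v(3) by simp
  qed
  have "poly P x = 0" for x
  proof (rule P.eq_0_on_span)
    show "x \<in> V.span (set bs)" using bs by (simp add: ordered_basis_def)
    show "poly P b = 0" if "b \<in> set bs" for b
      using that root len by (auto simp: in_set_conv_nth)
  qed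
  moreover have "degree P < CARD('a)"
  proof -
    have "degree P \<le> q ^ (n - 1)"
      unfolding P_def
    proof (rule degree_sum_le)
      fix i assume "i \<in> {..<n}"
      then have "q ^ i \<le> q ^ (n - 1)" using q_gt_1 by (intro power_increasing) auto
      then show "degree (monom (v $ i) (q ^ i)) \<le> q ^ (n - 1)"
        using degree_monom_le order_trans by blast
    qed simp
    also have "\<dots> < q ^ n" using q_gt_1 n_pos by (intro power_strict_increasing) auto
    finally show ?thesis by (simp add: card_ext)
  qed
  ultimately have "P = 0"
    using poly_eqI_degree[of UNIV P 0] by simp
  then have "v $ i = 0" if "i < n" for i
    using coeff_linearized[OF that, of "\<lambda>i. v $ i"] by (simp flip: P_def)
  then have "v = 0\<^sub>v n" using v(1) by (intro eq_vecI) auto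
  with v(2) show False by contradiction
qed

text \<open>Row \<open>i\<close> of the Dickson matrix is the coefficient vector of \<open>L\<close>, shifted cyclically by \<open>i\<close> and
  raised to the power \<open>q^i\<close>; applied to the conjugates of \<open>x\<close> it yields the conjugate \<open>L(x)^(q^i)\<close>.\<close>

lemma dickson_mult_moore_vec:
  assumes L: "L \<in> linearized_polys q n"
  shows "dickson_matrix q n L *\<^sub>v moore_vec x = moore_vec (poly L x)"
proof (rule eq_vecI)
  fix i assume "i < dim_vec (moore_vec (poly L x))"
  then have i: "i < n" by (simp add: moore_vec_def)
  have "(dickson_matrix q n L *\<^sub>v moore_vec x) $ i =
      (\<Sum>k<n. coeff L (q ^ ((n + k - i) mod n)) ^ q ^ i * x ^ q ^ k)"
    using i by (simp add: dickson_matrix_def moore_vec_def scalar_prod_def lessThan_atLeast0)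
  \<comment> \<open>substitute \<open>k = l + i\<close> modulo \<open>n\<close>\<close>
  also have "\<dots> = (\<Sum>l<n. coeff L (q ^ l) ^ q ^ i * x ^ q ^ (l + i))"
  proof (rule sum.reindex_bij_witness[of _ "\<lambda>l. (l + i) mod n" "\<lambda>k. (n + k - i) mod n"])
    fix k assume k: "k \<in> {..<n}"
    then show inv: "((n + k - i) mod n + i) mod n = k"
      using i by (simp add: mod_add_left_eq)
    show "coeff L (q ^ ((n + k - i) mod n)) ^ q ^ i * x ^ q ^ ((n + k - i) mod n + i) =
        coeff L (q ^ ((n + k - i) mod n)) ^ q ^ i * x ^ q ^ k"
      using frobenius_mod[of x "(n + k - i) mod n + i"] by (simp only: inv)
    show "(n + k - i) mod n \<in> {..<n}" using n_pos by simp
  next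
    fix l assume l: "l \<in> {..<n}"
    show "(n + (l + i) mod n - i) mod n = l"
      using i l by (cases "l + i < n") (auto simp: mod_if)
    show "(l + i) mod n \<in> {..<n}" using n_pos by simp
  qed
  also have "\<dots> = poly L x ^ q ^ i"
    by (simp add: poly_linearized[OF L] frobenius_sum power_mult_distrib power_add power_mult)
  finally show "(dickson_matrix q n L *\<^sub>v moore_vec x) $ i = moore_vec (poly L x) $ i"
    using i by (simp add: moore_vec_def)
qed (simp add: dickson_matrix_def moore_vec_def)

lemma dickson_carrier [simp]: "dickson_matrix q n L \<in> carrier_mat n n"
  by (simp add: dickson_matrix_def)

lemma dickson_mult_moore_mat:
  assumes L: "L \<in> linearized_polys q n"
  shows "dickson_matrix q n L * moore_mat xs = moore_mat (map (poly L) xs)"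
proof (rule mat_col_eqI)
  fix j assume "j < dim_col (moore_mat (map (poly L) xs))"
  then have j: "j < length xs" by (simp add: moore_mat_def)
  have "col (dickson_matrix q n L * moore_mat xs) j = dickson_matrix q n L *\<^sub>v col (moore_mat xs) j"
    by (rule col_mult2[of _ n n _ "length xs"]) (use j in auto)
  then show "col (dickson_matrix q n L * moore_mat xs) j = col (moore_mat (map (poly L) xs)) j"
    using j by (simp add: moore_mat_def dickson_mult_moore_vec[OF L])
qed (simp_all add: moore_mat_def dickson_matrix_def)

text \<open>Entries from the small field are fixed by the Frobenius map, so the expansion of \<open>f c\<close> in the
  basis \<open>bs\<close> also holds, with the same coefficients, for all conjugates.\<close>

lemma moore_mat_map:
  assumes bs: "ordered_basis (ext_scale \<iota>) bs"
  shows "moore_mat (map f cs) = moore_mat bs * map_mat \<iota> (matrix_of (ext_scale \<iota>) bs cs f)"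
proof (rule eq_matI)
  let ?A = "matrix_of (ext_scale \<iota>) bs cs f"
  fix i j assume "i < dim_row (moore_mat bs * map_mat \<iota> ?A)" "j < dim_col (moore_mat bs * map_mat \<iota> ?A)"
  then have ij: "i < n" "j < length cs" by (simp_all add: moore_mat_def matrix_of_def)
  have "f (cs ! j) = (\<Sum>k<length bs. \<iota> (?A $$ (k, j)) * bs ! k)"
    using V.ordered_basis_sum[OF bs, of "f (cs ! j)"] ij by (simp add: matrix_of_def ext_scale_def)
  then have "f (cs ! j) ^ q ^ i = (\<Sum>k<length bs. \<iota> (?A $$ (k, j)) * (bs ! k) ^ q ^ i)"
    by (simp add: frobenius_sum power_mult_distrib frobenius_base)
  then show "moore_mat (map f cs) $$ (i, j) = (moore_mat bs * map_mat \<iota> ?A) $$ (i, j)"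
    using ij by (simp add: moore_mat_index moore_mat_def[of bs] mat_of_cols_index moore_vec_def
        scalar_prod_def lessThan_atLeast0 matrix_of_def mult.commute)
qed (simp_all add: moore_mat_def matrix_of_def)


section \<open>Determinant and rank\<close>

lemma ex_ordered_basis_superset:
  assumes "V.independent S"
  obtains bs where "ordered_basis (ext_scale \<iota>) bs" "S \<subseteq> set bs"
proof -
  obtain bs where "set bs = V.extend_basis S" "distinct bs"
    using finite_distinct_list[of "V.extend_basis S"] by auto
  then show ?thesis
    using that assms V.extend_basis_superset V.independent_extend_basis V.span_extend_basis
    by (metis ordered_basis_def)
qed

lemma linear_det_eq_det_dickson:
  assumes L: "L \<in> linearized_polys q n"
  shows "\<iota> (linear_det (ext_scale \<iota>) (poly L)) = det (dickson_matrix q n L)"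
proof -
  obtain bs where bs: "ordered_basis (ext_scale \<iota>) bs"
    using ex_ordered_basis_superset[OF V.independent_empty] by blast
  let ?M = "moore_mat bs" and ?A = "matrix_of (ext_scale \<iota>) bs bs (poly L)"
  have len: "length bs = n" by (rule ordered_basis_length_eq[OF bs])
  have M: "?M \<in> carrier_mat n n" using moore_mat_carrier[of bs] len by simp
  have A: "?A \<in> carrier_mat n n" by (simp add: matrix_of_def len)
  have "dickson_matrix q n L * ?M = ?M * map_mat \<iota> ?A"
    by (simp add: dickson_mult_moore_mat[OF L] moore_mat_map[OF bs])
  then have "det (dickson_matrix q n L) * det ?M = det ?M * \<iota> (det ?A)"
    using M A by (metis det_mult dickson_carrier hom_det map_carrier_mat)
  then show ?thesis
    using det_moore_mat_nonzero[OF bs] V.linear_det_eq[OF linear_linearized[OF L] bs] by simp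
qed

lemma inj_moore_vec: "inj moore_vec"
proof (rule injI)
  fix x y assume "moore_vec x = moore_vec y"
  then have "moore_vec x $ 0 = moore_vec y $ 0" by simp
  then show "x = y" using n_pos by (simp add: moore_vec_def)
qed

text \<open>The map \<open>moore_vec\<close> preserves both spanning and independence when passing from the small field to
  the large one. It preserves spanning because it is linear over the small field, and independence
  because the Moore matrix of a basis is invertible. Hence a basis of the span of \<open>xs\<close> chosen among
  the \<open>xs\<close> goes to a maximal independent set of columns.\<close>

lemma rank_moore_mat:
  "vec_space.rank n (moore_mat xs) = V.dim (set xs)"
proof -
  interpret W: vec_space "TYPE('a)" n .
  obtain S where S: "S \<subseteq> set xs" "V.independent S" "set xs \<subseteq> V.span S" "card S = V.dim (set xs)"
    using V.basis_exists by blast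
  obtain bs where bs: "ordered_basis (ext_scale \<iota>) bs" "S \<subseteq> set bs"
    using ex_ordered_basis_superset[OF S(2)] .
  have "moore_mat bs \<in> carrier_mat n n"
    using moore_mat_carrier[of bs] ordered_basis_length_eq[OF bs(1)] by simp
  then have "W.lin_indpt (set (cols (moore_mat bs)))"
    using W.lin_dep_cols_imp_det_0 det_moore_mat_nonzero[OF bs(1)] by blast
  then have ind: "W.lin_indpt (moore_vec ` S)"
    by (rule W.subset_li_is_li) (use bs(2) in \<open>auto simp: cols_moore_mat\<close>)
  have car: "moore_vec ` S \<subseteq> carrier_vec n" by auto
  have "V.subspace {x. moore_vec x \<in> W.span (moore_vec ` S)}"
  proof (rule V.subspaceI)
    have "moore_vec 0 = 0\<^sub>v n" using q_gt_1 by (auto simp: moore_vec_def)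
    then show "0 \<in> {x. moore_vec x \<in> W.span (moore_vec ` S)}"
      using W.in_spanI[of "0\<^sub>v n" "\<lambda>_. 0" "{}" "moore_vec ` S"] by (simp add: W.lincomb_def)
    fix x y assume "x \<in> {x. moore_vec x \<in> W.span (moore_vec ` S)}"
      "y \<in> {x. moore_vec x \<in> W.span (moore_vec ` S)}"
    moreover have "moore_vec (x + y) = moore_vec x + moore_vec y"
      by (auto simp: moore_vec_def frobenius_add)
    ultimately show "x + y \<in> {x. moore_vec x \<in> W.span (moore_vec ` S)}"
      using W.span_add1[OF car] by simp
  next
    fix c x assume "x \<in> {x. moore_vec x \<in> W.span (moore_vec ` S)}"
    moreover have "moore_vec (ext_scale \<iota> c x) = \<iota> c \<cdot>\<^sub>v moore_vec x"
      by (auto simp: moore_vec_def ext_scale_def power_mult_distrib frobenius_base)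
    ultimately show "ext_scale \<iota> c x \<in> {x. moore_vec x \<in> W.span (moore_vec ` S)}"
      using W.smult_in_span[OF car] by simp
  qed
  moreover have "S \<subseteq> {x. moore_vec x \<in> W.span (moore_vec ` S)}"
    using W.in_own_span[of "moore_vec ` S"] car by auto
  ultimately have "V.span S \<subseteq> {x. moore_vec x \<in> W.span (moore_vec ` S)}"
    by (rule V.span_minimal[rotated])
  then have gen: "set (cols (moore_mat xs)) \<subseteq> W.span (moore_vec ` S)"
    using S(3) by (auto simp: cols_moore_mat)
  have "maximal (moore_vec ` S) (\<lambda>T. T \<subseteq> set (cols (moore_mat xs)) \<and> W.lin_indpt T)"
    unfolding maximal_def
  proof (intro conjI allI impI)
    show "moore_vec ` S \<subseteq> set (cols (moore_mat xs))" using S(1) by (auto simp: cols_moore_mat)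
    fix T assume T: "moore_vec ` S \<subseteq> T \<and> T \<subseteq> set (cols (moore_mat xs)) \<and> W.lin_indpt T"
    have "v \<in> moore_vec ` S" if v: "v \<in> T" for v
    proof (rule ccontr)
      assume nv: "v \<notin> moore_vec ` S"
      have vc: "v \<in> carrier_vec n" using v T by (auto simp: cols_moore_mat)
      have "W.lin_dep (moore_vec ` S \<union> {v})"
        using W.lin_dep_iff_in_span[of "moore_vec ` S" v] car ind vc nv gen v T by auto
      moreover have "moore_vec ` S \<union> {v} \<subseteq> T" using v T by auto
      ultimately show False using T W.subset_li_is_li by blast
    qed
    then show "T = moore_vec ` S" using T by blast
  qed (fact ind)
  then have "W.rank (moore_mat xs) = card (moore_vec ` S)"
    by (rule W.rank_card_indpt[OF moore_mat_carrier])
  also have "\<dots> = card S" using inj_moore_vec by (metis card_image inj_on_subset subset_UNIV)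
  finally show ?thesis using S(4) by simp
qed

lemma linear_rank_eq_rank_dickson:
  assumes L: "L \<in> linearized_polys q n"
  shows "linear_rank (ext_scale \<iota>) (poly L) = vec_space.rank n (dickson_matrix q n L)"
proof -
  interpret W: vec_space "TYPE('a)" n .
  interpret L: Vector_Spaces.linear "ext_scale \<iota>" "ext_scale \<iota>" "poly L"
    by (rule linear_linearized[OF L])
  obtain bs where bs: "ordered_basis (ext_scale \<iota>) bs"
    using ex_ordered_basis_superset[OF V.independent_empty] by blast
  have M: "moore_mat bs \<in> carrier_mat n n"
    using moore_mat_carrier[of bs] ordered_basis_length_eq[OF bs] by simp
  have "W.rank (dickson_matrix q n L) = W.rank (dickson_matrix q n L * moore_mat bs)"
    using W.rank_mult_invertible_right[OF dickson_carrier M det_moore_mat_nonzero[OF bs]] by simp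
  also have "\<dots> = V.dim (poly L ` set bs)"
    by (simp add: dickson_mult_moore_mat[OF L] rank_moore_mat)
  also have "\<dots> = V.dim (range (poly L))"
    using L.span_image[of "set bs"] bs by (metis V.dim_span ordered_basis_def)
  finally show ?thesis by (simp add: linear_rank_def)
qed

end

theorem proposition4p3:
  fixes q n :: nat
    and \<iota> :: "'k::{field, finite} \<Rightarrow> 'a::{field, finite}"
    and L :: "'a poly"
  assumes "primepow q" and "n \<ge> 1"
    and "CARD('k) = q" and "CARD('a) = q ^ n"
    and "field_hom \<iota>"
    and "L \<in> linearized_polys q n"
  shows "linear_rank (ext_scale \<iota>) (poly L) = vec_space.rank n (dickson_matrix q n L) \<and>
         \<iota> (linear_det (ext_scale \<iota>) (poly L)) = det (dickson_matrix q n L)"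
proof -
  interpret field_hom \<iota> by fact
  interpret E: finite_field_extension \<iota> q n
    by unfold_locales (use assms in auto)
  show ?thesis
    using E.linear_rank_eq_rank_dickson[of L] E.linear_det_eq_det_dickson[of L] assms by simp
qed

end
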